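(* Let $t$ be an indeterminate, put $k=t^2+1\in\mathbb{Q}[t]$, and let $m$ be a positive integer. Then \[ H_m(t)=\frac{k^2}{4(k-1)}\left(k^{2m+2}+2(k-2)k^{m}+1\right) \] is a polynomial in $\mathbb{Q}[t]$, and the set of non-negative integers $n$ for which there exists a polynomial $x\in\mathbb{Q}[t]$ with $x^2+k^{n}=H_m(t)$ in $\mathbb{Q}[t]$ is exactly $\{0,\ m+2,\ 2m+2\}$. The corresponding solutions are (up to the sign of $x$) \[ (x,n)=\Big(\frac{k^{m+2}+k-2}{2t}, 0\Big),\ \Big(\frac{k(k^{m+1}-1)}{2t}, m+2\Big),\ \Big(\frac{k(k^{m}(k-2)+1)}{2t}, 2m+2\Big). \] *)

theory Defs
  imports "HOL-Computational_Algebra.Polynomial_Factorial"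
begin

text \<open>
  Quotients are taken in the fraction field of the polynomial ring (the rational functions over
  the rationals), into which \<^const>\<open>to_fract\<close> embeds the ring. So being a polynomial means lying in
  the range of this embedding.
\<close>

definition t :: "rat poly" where
  "t = [:0, 1:]"

definition k :: "rat poly" where
  "k = t\<^sup>2 + 1"

abbreviation T :: "rat poly fract" where
  "T \<equiv> to_fract t"

abbreviation K :: "rat poly fract" where
  "K \<equiv> to_fract k"

definition H :: "nat \<Rightarrow> rat poly fract" where
  "H m = K\<^sup>2 / (4 * (K - 1)) * (K ^ (2 * m + 2) + 2 * (K - 2) * K ^ m + 1)"

end

theory Submission
  imports Defs
begin

text \<open>
  Put \<open>y = 2 t x\<close>, so that the equation reads
  \<open>y\<^sup>2 + 4 (k - 1) k\<^sup>n = k\<^sup>2 (k\<^bsup>2 m + 2\<^esup> + 2 (k - 2) k\<^sup>m + 1)\<close> and \<open>y\<close> vanishes at \<open>0\<close>.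
  As \<open>k\<close> is irreducible over the rationals, for \<open>n > 0\<close> it divides \<open>y\<close>, which excludes \<open>n = 1\<close>
  and leaves, with \<open>y = k w\<close> and \<open>n = N + 2\<close>, the equation
  \<open>w\<^sup>2 + 4 (k - 1) k\<^sup>N = k\<^bsup>2 m + 2\<^esup> + 2 (k - 2) k\<^sup>m + 1\<close>. Leading coefficients on the left are positive,
  so \<open>w\<close> has degree at most \<open>2 m + 2\<close> in \<open>t\<close>.
  If \<open>N \<le> m\<close>, then \<open>(w - k\<^bsup>m + 1\<^esup>) (w + k\<^bsup>m + 1\<^esup>)\<close> has degree at most \<open>2 m + 2\<close>, so up to sign
  \<open>w = k\<^bsup>m + 1\<^esup> + c\<close> with a constant \<open>c\<close>. If \<open>N > m\<close>, then \<open>k\<^sup>m\<close> divides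
  \<open>(w - 1) (w + 1)\<close>, so up to sign \<open>w = 1 + k\<^sup>m u\<close>, where \<open>u\<close> has degree at most \<open>2\<close> and
  \<open>u \<equiv> - 2\<close> modulo \<open>k\<close>, so \<open>u = c k - 2\<close>. In both cases \<open>w(0) = 0\<close> determines \<open>c\<close>,
  and the equation becomes \<open>k\<^sup>N = k\<^sup>m\<close> or \<open>k\<^sup>N = k\<^bsup>2 m\<^esup>\<close>.
\<close>

section \<open>Preliminaries on the embedding and on degrees of sums\<close>

lemma to_fract_power [simp]: "to_fract (a ^ n) = to_fract a ^ n"
  by (induction n) auto

lemma to_fract_numeral [simp]: "to_fract (numeral n) = numeral n"
  by (induction n) (simp_all only: numeral.simps to_fract_add to_fract_1)

text \<open>Nonnegative leading coefficients cannot cancel, so a degree bound on the sum bounds each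
  summand.\<close>

lemma degree_add_eq_max:
  fixes p q :: "'a :: linordered_idom poly"
  assumes "lead_coeff p \<ge> 0" "lead_coeff q \<ge> 0"
  shows "degree (p + q) = max (degree p) (degree q)"
proof (cases "degree p = degree q \<and> p \<noteq> 0")
  case True
  then have "coeff (p + q) (degree q) > 0"
    using assms leading_coeff_neq_0[of p] by (simp add: add_pos_nonneg)
  then have "degree (p + q) \<ge> degree q"
    by (intro le_degree) auto
  with True show ?thesis
    using degree_add_le_max[of p q] by auto
next
  case False
  then show ?thesis
    by (cases "degree p" "degree q" rule: linorder_cases)
       (auto simp: degree_add_eq_left degree_add_eq_right)
qed

section \<open>Degrees, powers and primality of \<open>k\<close>\<close>

lemma poly_k: "poly k a = a\<^sup>2 + 1"
  by (simp add: k_def t_def)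

lemma degree_k: "degree k = 2"
  by (simp add: k_def t_def power2_eq_square one_pCons)

lemma lead_coeff_k: "lead_coeff k = 1"
  by (simp add: k_def t_def power2_eq_square one_pCons)

lemma k_minus_1: "k - 1 = t\<^sup>2"
  by (simp add: k_def)

lemma t_nonzero: "t \<noteq> 0"
  by (simp add: t_def)

lemma k_minus_1_nonzero: "k - 1 \<noteq> 0"
  by (simp add: k_minus_1 t_nonzero)

lemma k_nonzero: "k \<noteq> 0"
  using degree_k by auto

lemma degree_k_power: "degree (k ^ n) = 2 * n"
  by (simp add: degree_power_eq k_nonzero degree_k)

lemma degree_k_minus: "degree (k - numeral n) = 2" "degree (k - 1) = 2"
  using degree_add_eq_left[of "- numeral n" k] degree_add_eq_left[of "- 1" k]
  by (simp_all add: degree_k)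

lemma degree_mult_k_power: "degree (2 * (k - 2) * k ^ m) = 2 * m + 2"
  "degree (4 * (k - 1) * k ^ m) = 2 * m + 2"
proof -
  have "k - 2 \<noteq> 0" using degree_k_minus(1)[of "num.Bit0 num.One"] by auto
  then show "degree (2 * (k - 2) * k ^ m) = 2 * m + 2" "degree (4 * (k - 1) * k ^ m) = 2 * m + 2"
    using k_nonzero k_minus_1_nonzero
    by (simp_all add: degree_mult_eq degree_k_power degree_k_minus
      del: right_diff_distrib_numeral)
qed

lemma k_power_eq_iff: "k ^ a = k ^ b \<longleftrightarrow> a = b"
  using degree_k_power by (metis mult_left_cancel zero_neq_numeral)

text \<open>A proper factor of a quadratic is linear and so has a rational root, but
  \<open>k\<close> takes only positive values.\<close>

lemma prime_elem_k: "prime_elem k"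
proof (rule field_poly_irreducible_imp_prime, rule irreducibleI)
  show "k \<noteq> 0" by (rule k_nonzero)
  show "\<not> k dvd 1"
    using degree_k by (auto simp: is_unit_iff_degree k_nonzero)
next
  fix a b assume ab: "k = a * b"
  then have nz: "a \<noteq> 0" "b \<noteq> 0" using k_nonzero by auto
  with ab have deg: "degree a + degree b = 2"
    using degree_k degree_mult_eq by metis
  show "a dvd 1 \<or> b dvd 1"
  proof (rule ccontr)
    assume "\<not> ?thesis"
    with nz have "degree a \<noteq> 0" "degree b \<noteq> 0"
      by (auto simp: is_unit_iff_degree)
    with deg have "degree a = 1" by simp
    moreover obtain c p where a: "a = pCons c p" by (cases a)
    ultimately have "degree p = 0" "p \<noteq> 0" by (auto split: if_splits)
    then obtain d where "p = [:d:]" "d \<noteq> 0"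
      by (metis degree_eq_zeroE pCons_0_0)
    with a have "poly a (- c / d) = 0" by simp
    then have "poly k (- c / d) = 0" by (simp add: ab)
    then have "(- c / d)\<^sup>2 + 1 = 0" by (simp only: poly_k)
    then show False
      using zero_le_power2[of "- c / d"] by linarith
  qed
qed

lemma not_k_dvd_numeral: "\<not> k dvd numeral n"
  using dvd_imp_degree_le[of k "numeral n"] degree_k by auto

section \<open>The reduced equation for \<open>w\<close>\<close>

lemma reduced_equation_low:
  assumes eq: "w\<^sup>2 + 4 * (k - 1) * k ^ N = k ^ (2 * m + 2) + 2 * (k - 2) * k ^ m + 1"
    and w0: "poly w 0 = 0" and deg: "degree (w - k ^ (m + 1)) = 0"
  shows "N = m"
proof -
  from deg obtain c where "w - k ^ (m + 1) = [:c:]"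
    by (auto elim: degree_eq_zeroE)
  then have w: "w = k ^ (m + 1) + [:c:]" by (simp add: algebra_simps)
  \<comment> \<open>\<open>k\<close> takes the value 1 at 0.\<close>
  with w0 have "c = - 1" by (simp add: poly_k)
  with w have w: "w = k ^ (m + 1) - 1" by (simp add: one_pCons)
  have "4 * (k - 1) * k ^ N = 4 * (k - 1) * k ^ m"
    \<comment> \<open>An equation follows from \<open>eq\<close> once the differences of their two
      sides agree, which is a ring identity; the same device recurs below.\<close>
    by (rule iffD1[OF diff_eq_diff_eq eq]) (simp only: w mult_2 power_add power_one_right, algebra)
  then have "k ^ N = k ^ m" using k_minus_1_nonzero by simp
  then show ?thesis by (simp add: k_power_eq_iff)
qed

lemma reduced_equation_high:
  assumes eq: "w\<^sup>2 + 4 * (k - 1) * k ^ N = k ^ (2 * m + 2) + 2 * (k - 2) * k ^ m + 1"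
    and w0: "poly w 0 = 0" and deg: "degree w \<le> 2 * m + 2"
    and dvd: "k ^ m dvd w - 1" and m: "m > 0" and N: "N > m"
  shows "N = 2 * m"
proof -
  \<comment> \<open>Successors expose a factor \<open>k\<close> in both powers that remain after
    cancelling \<open>k ^ m\<close>.\<close>
  obtain j where N: "N = m + Suc j"
    using N less_imp_Suc_add by auto
  obtain l where m': "m = Suc l"
    using m gr0_implies_Suc by auto
  obtain u where "w - 1 = k ^ m * u"
    using dvd by (auto elim: dvdE)
  then have w: "w = 1 + k ^ m * u" by (simp add: algebra_simps)
  have u0: "poly u 0 = - 1"
    using w0 by (simp add: w poly_k)
  have "degree (k ^ m * u) \<le> 2 * m + 2"
    using degree_diff_le[OF deg, of 1] by (simp add: w)
  then have degu: "degree u \<le> 2"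
    using u0 by (cases "u = 0") (auto simp: degree_mult_eq k_nonzero degree_k_power)
  have "k ^ m * (2 * u + k ^ m * u\<^sup>2 + 4 * (k - 1) * k ^ Suc j)
      = k ^ m * (k ^ m * k\<^sup>2 + 2 * (k - 2))"
    by (rule iffD1[OF diff_eq_diff_eq eq])
       (simp only: w N mult_2 power_add power_one_right, algebra)
  then have eq': "2 * u + k ^ m * u\<^sup>2 + 4 * (k - 1) * k ^ Suc j = k ^ m * k\<^sup>2 + 2 * (k - 2)"
    using k_nonzero by simp
  \<comment> \<open>This is \<open>eq'\<close> read modulo \<open>k\<close>.\<close>
  have "2 * (u + 2) = k * (2 - k ^ l * u\<^sup>2 - 4 * (k - 1) * k ^ j + k ^ l * k\<^sup>2)"
    by (rule iffD1[OF diff_eq_diff_eq eq']) (simp only: m' power_Suc, algebra)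
  then have "k dvd 2 * (u + 2)" by (rule dvdI)
  then have "k dvd u + 2"
    using prime_elem_k not_k_dvd_numeral prime_elem_dvd_multD by blast
  then obtain v where v: "u + 2 = k * v" by (auto elim: dvdE)
  \<comment> \<open>At 0 the factorization reads -1 + 2 = 1 * v(0); since \<open>v\<close> turns out
    constant, this value determines it.\<close>
  have v0: "poly v 0 = 1"
    using arg_cong[OF v, of "\<lambda>p. poly p 0"] u0 by (simp add: poly_k)
  have "degree (k * v) \<le> 2"
    unfolding v[symmetric] using degree_add_le[OF degu, of 2] by simp
  with v0 have "degree v = 0"
    by (cases "v = 0") (auto simp: degree_mult_eq k_nonzero degree_k)
  with v0 have "v = 1"
    by (auto elim!: degree_eq_zeroE simp: one_pCons)
  with v have u: "u = k - 2" by (simp add: algebra_simps)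
  have "4 * (k - 1) * k ^ Suc j = 4 * (k - 1) * k ^ m"
    by (rule iffD1[OF diff_eq_diff_eq eq']) (simp only: u, algebra)
  then have "k ^ Suc j = k ^ m" using k_minus_1_nonzero by simp
  then show ?thesis unfolding k_power_eq_iff N by simp
qed

lemma reduced_equation_exponent:
  assumes eq: "w\<^sup>2 + 4 * (k - 1) * k ^ N = k ^ (2 * m + 2) + 2 * (k - 2) * k ^ m + 1"
    and w0: "poly w 0 = 0" and m: "m > 0"
  shows "N = m \<or> N = 2 * m"
proof -
  have "degree (w\<^sup>2 + 4 * (k - 1) * k ^ N) = max (degree (w\<^sup>2)) (degree (4 * (k - 1) * k ^ N))"
  proof (rule degree_add_eq_max)
    show "lead_coeff (w\<^sup>2) \<ge> 0"
      by (simp add: lead_coeff_power)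
    have "lead_coeff (k - 1) = 1"
      by (simp add: k_minus_1 t_def power2_eq_square)
    then show "lead_coeff (4 * (k - 1) * k ^ N) \<ge> 0"
      by (simp only: lead_coeff_mult lead_coeff_power lead_coeff_k lead_coeff_numeral) simp
  qed
  moreover have "degree (k ^ (2 * m + 2) + 2 * (k - 2) * k ^ m + 1) \<le> 2 * (2 * m + 2)"
  proof (intro degree_add_le)
    show "degree (k ^ (2 * m + 2)) \<le> 2 * (2 * m + 2)"
      unfolding degree_k_power ..
    show "degree (2 * (k - 2) * k ^ m) \<le> 2 * (2 * m + 2)"
      unfolding degree_mult_k_power by simp
  qed simp
  ultimately have "degree (w\<^sup>2) \<le> 2 * (2 * m + 2)"
    using eq by simp
  then have deg: "degree w \<le> 2 * m + 2"
    by (cases "w = 0") (simp_all add: degree_power_eq)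
  \<comment> \<open>The equation is even in \<open>w\<close>, so the other sign choice is the same
    lemma applied to \<open>- w\<close>.\<close>
  have eq_neg: "(- w)\<^sup>2 + 4 * (k - 1) * k ^ N = k ^ (2 * m + 2) + 2 * (k - 2) * k ^ m + 1"
    using eq by simp
  show ?thesis
  proof (cases "N \<le> m")
    case True
    \<comment> \<open>Since \<open>b - a\<close> has degree \<open>2 * m + 2\<close>, one of the
      factors has at least that degree; the product has at most that degree, so the other factor is
      constant.\<close>
    define a b where "a = w - k ^ (m + 1)" and "b = w + k ^ (m + 1)"
    have "b - a = 2 * k ^ (m + 1)" by (simp add: a_def b_def)
    then have "degree (b - a) = 2 * m + 2"
      using k_nonzero by (simp add: degree_mult_eq degree_k_power del: power_Suc)
    then have ab: "2 * m + 2 \<le> max (degree a) (degree b)"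
      using degree_diff_le_max[of b a] by (simp add: max.commute)
    have "a * b = 2 * (k - 2) * k ^ m + 1 - 4 * (k - 1) * k ^ N"
      by (rule iffD1[OF diff_eq_diff_eq eq])
         (simp only: a_def b_def mult_2 power_add power_one_right, algebra)
    moreover have "degree (2 * (k - 2) * k ^ m + 1 - 4 * (k - 1) * k ^ N) \<le> 2 * m + 2"
      using True by (intro degree_add_le degree_diff_le) (simp_all only: degree_mult_k_power, simp_all)
    ultimately have "degree (a * b) \<le> 2 * m + 2" by simp
    with ab have "degree a = 0 \<or> degree b = 0"
      by (cases "a = 0 \<or> b = 0") (auto simp: degree_mult_eq)
    moreover have "degree (- w - k ^ (m + 1)) = degree b"
      unfolding b_def by (metis degree_minus minus_add_distrib uminus_add_conv_diff add.commute)
    ultimately show ?thesis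
      using reduced_equation_low[OF eq w0] reduced_equation_low[OF eq_neg] w0
      by (auto simp: a_def)
  next
    case False
    then obtain j where N: "N = m + j" using le_Suc_ex nat_le_linear by blast
    have "(w - 1) * (w + 1) = k ^ m * (k ^ m * k\<^sup>2 + 2 * (k - 2) - 4 * (k - 1) * k ^ j)"
      by (rule iffD1[OF diff_eq_diff_eq eq]) (simp only: N mult_2 power_add, algebra)
    then have dvd: "k ^ m dvd (w - 1) * (w + 1)" by simp
    \<comment> \<open>The prime \<open>k\<close> cannot divide both factors, whose difference is 2,
      so all of \<open>k ^ m\<close> goes into one of them.\<close>
    have "k ^ m dvd w - 1 \<or> k ^ m dvd w + 1"
    proof (cases "k dvd w - 1")
      case True
      have "\<not> k dvd w + 1"
      proof
        assume "k dvd w + 1"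
        with True have "k dvd (w + 1) - (w - 1)" by (rule dvd_diff[rotated])
        then show False using not_k_dvd_numeral[of "num.Bit0 num.One"] by simp
      qed
      with dvd show ?thesis
        using prime_power_dvd_multD[OF prime_elem_k] m by (metis mult.commute)
    next
      case False
      with dvd show ?thesis
        using prime_power_dvd_multD[OF prime_elem_k] m by blast
    qed
    moreover have "k ^ m dvd - w - 1 \<longleftrightarrow> k ^ m dvd w + 1"
      using dvd_minus_iff[of "k ^ m" "w + 1"] by simp
    ultimately show ?thesis
      using reduced_equation_high[OF eq w0 deg] reduced_equation_high[OF eq_neg] w0 deg m False
      by auto
  qed
qed

section \<open>The equation for \<open>y\<close> and all its solutions\<close>

lemma equation_exponent:
  assumes eq: "y\<^sup>2 + 4 * (k - 1) * k ^ n = k\<^sup>2 * (k ^ (2 * m + 2) + 2 * (k - 2) * k ^ m + 1)"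
    and y0: "poly y 0 = 0" and m: "m > 0"
  shows "n \<in> {0, m + 2, 2 * m + 2}"
proof (cases n)
  case (Suc j)
  define r where "r = k ^ (2 * m + 2) + 2 * (k - 2) * k ^ m + 1"
  have "y\<^sup>2 = k * (k * r - 4 * (k - 1) * k ^ j)"
    using eq unfolding r_def[symmetric] Suc
    by (simp add: algebra_simps power2_eq_square)
  then have "k dvd y\<^sup>2" by simp
  then obtain w where y: "y = k * w"
    using prime_elem_dvd_power[OF prime_elem_k] by (blast elim: dvdE)
  have w0: "poly w 0 = 0"
    using y0 by (simp add: y poly_k)
  show ?thesis
  proof (cases j)
    case 0
    \<comment> \<open>Here \<open>n = 1\<close>: every term except \<open>- 4 * k\<close> is
      divisible by the square of \<open>k\<close>, which would force \<open>k\<close> to divide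
      4.\<close>
    have "k * 4 = k * (k * (w\<^sup>2 + 4 - r))"
      by (rule iffD1[OF diff_eq_diff_eq eq[symmetric]])
         (simp only: r_def[symmetric] Suc 0 y power_Suc power_0, algebra)
    then have "4 = k * (w\<^sup>2 + 4 - r)"
      using mult_left_cancel[OF k_nonzero] by blast
    then have "k dvd 4" by (rule dvdI)
    then show ?thesis
      using not_k_dvd_numeral by blast
  next
    case (Suc N)
    have "k\<^sup>2 * (w\<^sup>2 + 4 * (k - 1) * k ^ N) = k\<^sup>2 * r"
      by (rule iffD1[OF diff_eq_diff_eq eq])
         (simp only: r_def[symmetric] \<open>n = Suc j\<close> Suc y power_Suc, algebra)
    then have "w\<^sup>2 + 4 * (k - 1) * k ^ N = r"
      using k_nonzero by simp
    from reduced_equation_exponent[OF this[unfolded r_def] w0 m] show ?thesis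
      by (auto simp: \<open>n = Suc j\<close> Suc)
  qed
qed simp

lemma equation_solutions:
  "(k ^ (m + 2) + k - 2)\<^sup>2 + 4 * (k - 1) * k ^ 0
     = k\<^sup>2 * (k ^ (2 * m + 2) + 2 * (k - 2) * k ^ m + 1)"
  "(k * (k ^ (m + 1) - 1))\<^sup>2 + 4 * (k - 1) * k ^ (m + 2)
     = k\<^sup>2 * (k ^ (2 * m + 2) + 2 * (k - 2) * k ^ m + 1)"
  "(k * (k ^ m * (k - 2) + 1))\<^sup>2 + 4 * (k - 1) * k ^ (2 * m + 2)
     = k\<^sup>2 * (k ^ (2 * m + 2) + 2 * (k - 2) * k ^ m + 1)"
  \<comment> \<open>Once the exponents are split, these are identities in \<open>k\<close> and
    \<open>k ^ m\<close> as independent quantities.\<close>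
  by (simp_all only: mult_2 power_add power_one_right power_0; algebra)+

text \<open>For fixed \<open>n\<close> the equation determines the square of \<open>y\<close>, so
  one known solution per admissible exponent gives all of them up to sign.\<close>

lemma equation_iff:
  assumes y0: "poly y 0 = 0" and m: "m > 0"
  shows "y\<^sup>2 + 4 * (k - 1) * k ^ n = k\<^sup>2 * (k ^ (2 * m + 2) + 2 * (k - 2) * k ^ m + 1) \<longleftrightarrow>
    n = 0 \<and> (y = k ^ (m + 2) + k - 2 \<or> y = - (k ^ (m + 2) + k - 2)) \<or>
    n = m + 2 \<and> (y = k * (k ^ (m + 1) - 1) \<or> y = - (k * (k ^ (m + 1) - 1))) \<or>
    n = 2 * m + 2 \<and> (y = k * (k ^ m * (k - 2) + 1) \<or> y = - (k * (k ^ m * (k - 2) + 1)))"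
    (is "?lhs \<longleftrightarrow> ?rhs")
proof
  assume eq: ?lhs
  have *: "y = z \<or> y = - z"
    if "z\<^sup>2 + 4 * (k - 1) * k ^ n = k\<^sup>2 * (k ^ (2 * m + 2) + 2 * (k - 2) * k ^ m + 1)" for z
    using eq that by (metis add_right_cancel power2_eq_iff)
  from equation_exponent[OF eq y0 m] consider "n = 0" | "n = m + 2" | "n = 2 * m + 2"
    by auto
  then show ?rhs
    using *[of "k ^ (m + 2) + k - 2"] *[of "k * (k ^ (m + 1) - 1)"]
      *[of "k * (k ^ m * (k - 2) + 1)"] equation_solutions[of m]
    by cases metis+
next
  assume ?rhs
  then show ?lhs
    using equation_solutions[of m] by (elim disjE conjE) (simp_all only: power2_minus)
qed

section \<open>Clearing denominators and returning to \<open>x\<close>\<close>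

lemma to_fract_eq_H_iff:
  "to_fract p = H m \<longleftrightarrow> 4 * (k - 1) * p = k\<^sup>2 * (k ^ (2 * m + 2) + 2 * (k - 2) * k ^ m + 1)"
proof -
  let ?r = "k\<^sup>2 * (k ^ (2 * m + 2) + 2 * (k - 2) * k ^ m + 1)"
  have "to_fract (4 * (k - 1)) \<noteq> 0"
    unfolding to_fract_eq_0_iff using k_minus_1_nonzero by simp
  moreover have "H m = to_fract ?r / to_fract (4 * (k - 1))"
    by (simp add: H_def)
  ultimately have "to_fract p = H m \<longleftrightarrow> to_fract (4 * (k - 1)) * to_fract p = to_fract ?r"
    by (metis nonzero_eq_divide_eq mult.commute)
  also have "\<dots> \<longleftrightarrow> 4 * (k - 1) * p = ?r"
    unfolding to_fract_mult[symmetric] to_fract_eq_iff ..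
  finally show ?thesis .
qed

lemma to_fract_eq_half_iff: "to_fract x = to_fract p / (2 * T) \<longleftrightarrow> 2 * t * x = p"
proof -
  have "2 * T \<noteq> 0" using t_nonzero by (simp flip: to_fract_numeral)
  then have "to_fract x = to_fract p / (2 * T) \<longleftrightarrow> to_fract (2 * t * x) = to_fract p"
    by (simp add: eq_divide_eq mult.commute)
  then show ?thesis unfolding to_fract_eq_iff .
qed

text \<open>A root at 0 gives divisibility by \<open>t\<close>, and 2 is invertible over the
  rationals; this makes the listed fractions polynomials.\<close>

lemma ex_half:
  assumes "poly p 0 = 0"
  shows "\<exists>x. 2 * t * x = p"
proof -
  have "t dvd p"
    using assms poly_eq_0_iff_dvd[of p 0] by (simp add: t_def)
  then obtain q where "p = t * q" by (auto elim: dvdE)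
  then have "2 * t * smult (1 / 2) q = p"
    by (simp add: numeral_poly)
  then show ?thesis ..
qed

theorem theorem4p1:
  fixes m :: nat
  assumes "m > 0"
  shows "H m \<in> range to_fract
    \<and> {n::nat. \<exists>x::rat poly. to_fract (x\<^sup>2 + k ^ n) = H m} = {0, m + 2, 2 * m + 2}
    \<and> {(to_fract x, n) | (x::rat poly) (n::nat). to_fract (x\<^sup>2 + k ^ n) = H m} =
        {((K ^ (m + 2) + K - 2) / (2 * T), 0),
         (- ((K ^ (m + 2) + K - 2) / (2 * T)), 0),
         (K * (K ^ (m + 1) - 1) / (2 * T), m + 2),
         (- (K * (K ^ (m + 1) - 1) / (2 * T)), m + 2),
         (K * (K ^ m * (K - 2) + 1) / (2 * T), 2 * m + 2),
         (- (K * (K ^ m * (K - 2) + 1) / (2 * T)), 2 * m + 2)}"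
proof -
  define y\<^sub>0 y\<^sub>1 y\<^sub>2 where y_defs: "y\<^sub>0 = k ^ (m + 2) + k - 2"
    "y\<^sub>1 = k * (k ^ (m + 1) - 1)" "y\<^sub>2 = k * (k ^ m * (k - 2) + 1)"
  have sol: "to_fract (x\<^sup>2 + k ^ n) = H m \<longleftrightarrow>
      n = 0 \<and> (2 * t * x = y\<^sub>0 \<or> 2 * t * x = - y\<^sub>0) \<or>
      n = m + 2 \<and> (2 * t * x = y\<^sub>1 \<or> 2 * t * x = - y\<^sub>1) \<or>
      n = 2 * m + 2 \<and> (2 * t * x = y\<^sub>2 \<or> 2 * t * x = - y\<^sub>2)" for x n
  proof -
    have "4 * (k - 1) * (x\<^sup>2 + k ^ n) = (2 * t * x)\<^sup>2 + 4 * (k - 1) * k ^ n"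
      by (simp add: k_minus_1 power_mult_distrib algebra_simps)
    moreover have "poly (2 * t * x) 0 = 0" by (simp add: t_def)
    ultimately show ?thesis
      unfolding to_fract_eq_H_iff y_defs using equation_iff[OF _ assms] by simp
  qed
  \<comment> \<open>At 0, where \<open>k\<close> is 1, the three numerators become 1 + 1 - 2, 1 - 1
    and -1 + 1.\<close>
  have ex: "\<exists>x. 2 * t * x = y\<^sub>0" "\<exists>x. 2 * t * x = y\<^sub>1" "\<exists>x. 2 * t * x = y\<^sub>2"
    by (rule ex_half, simp add: y_defs poly_k)+
  then obtain x\<^sub>0 x\<^sub>1 x\<^sub>2 where x: "2 * t * x\<^sub>0 = y\<^sub>0" "2 * t * x\<^sub>1 = y\<^sub>1" "2 * t * x\<^sub>2 = y\<^sub>2"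
    by blast
  have fract: "(K ^ (m + 2) + K - 2) / (2 * T) = to_fract x\<^sub>0"
      "K * (K ^ (m + 1) - 1) / (2 * T) = to_fract x\<^sub>1"
      "K * (K ^ m * (K - 2) + 1) / (2 * T) = to_fract x\<^sub>2"
    using x[folded to_fract_eq_half_iff] by (simp_all add: y_defs)
  have cancel: "2 * t * x = 2 * t * x' \<longleftrightarrow> x = x'" "2 * t * x = - (2 * t * x') \<longleftrightarrow> x = - x'"
    for x x'
    using t_nonzero mult_left_cancel[of "2 * t" x "- x'"] by simp_all
  have sol: "to_fract (x\<^sup>2 + k ^ n) = H m \<longleftrightarrow>
      n = 0 \<and> (x = x\<^sub>0 \<or> x = - x\<^sub>0) \<or>
      n = m + 2 \<and> (x = x\<^sub>1 \<or> x = - x\<^sub>1) \<or>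
      n = 2 * m + 2 \<and> (x = x\<^sub>2 \<or> x = - x\<^sub>2)" for x n
    unfolding sol x[symmetric] cancel ..
  \<comment> \<open>The solution with \<open>n = 0\<close> exhibits \<open>H m\<close> as the image
    of the polynomial \<open>x\<^sub>0\<^sup>2 + 1\<close>.\<close>
  have "H m \<in> range to_fract"
    using sol[of x\<^sub>0 0] by (metis rangeI)
  moreover have "{n. \<exists>x. to_fract (x\<^sup>2 + k ^ n) = H m} = {0, m + 2, 2 * m + 2}"
    unfolding sol by blast
  moreover have "{(to_fract x, n) | x n. to_fract (x\<^sup>2 + k ^ n) = H m} =
      {(to_fract x\<^sub>0, 0), (- to_fract x\<^sub>0, 0), (to_fract x\<^sub>1, m + 2), (- to_fract x\<^sub>1, m + 2),
       (to_fract x\<^sub>2, 2 * m + 2), (- to_fract x\<^sub>2, 2 * m + 2)}"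
    unfolding sol to_fract_uminus[symmetric] by blast
  ultimately show ?thesis
    unfolding fract by blast
qed

end
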